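(* In the partition-wise setting of the context, let $\mathcal{P}^G=\{p\in\mathbb{R}^N:\ p_n>0\ \forall n,\ \sum_{n=1}^N p_n<1\}$. Given any $p^G\in\mathcal{P}^G$, there is a unique vector $z(p^G)\in\mathbb{R}^N$ such that $z=z(p^G)$ satisfies $$p^G_n=\frac{\underline{\mathcal{G}}^n(z_n)}{1+\sum_{l=1}^N\underline{\mathcal{G}}^l(z_l)}\qquad\forall n\in\{1,\dots,N\},$$ and this vector can be found by bisection. Moreover, $p^G\mapsto\mathcal{W}(z(p^G))$ is strictly concave in $p^G$ on $\mathcal{P}^G$, where $$\mathcal{W}(z)=\frac{\sum_{n=1}^N z_n\underline{\mathcal{G}}^n(z_n)}{1+\sum_{n=1}^N\underline{\mathcal{G}}^n(z_n)}.$$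
   Context: A GEV choice probability generating function (CPGF) on $k$ products is a smooth function $G$ of vectors $Y=(Y_1,\dots,Y_k)$ with positive entries such that: (i) $G(Y)\ge 0$; (ii) $G(\lambda Y)=\lambda G(Y)$ for $\lambda>0$; (iii) $G(Y)\to\infty$ if $Y_i\to\infty$; (iv) for distinct indices $i_1,\dots,i_j$, the mixed partial derivative $\partial G_{i_1,\dots,i_j}(Y)$ is $>0$ if $j$ is odd and $\le 0$ if $j$ is even. (Consequently $G(Y)=\sum_i Y_i\partial G_i(Y)$ and $\sum_j Y_j\partial G_{ij}(Y)=0$ for all $i$.) Partition-wise setting: the products $\mathcal{V}=\{1,\dots,m\}$, with costs $c\in\mathbb{R}^m$, are partitioned into nonempty disjoint subsets $\mathcal{V}_1,\dots,\mathcal{V}_N$. For each $n$, $G^n$ is a CPGF in the variables $Y^n=(Y_i)_{i\in\mathcal{V}_n}$. The uncertainty set is $\mathcal{A}=\mathcal{A}^1\times\dots\times\mathcal{A}^N$ with each $\mathcal{A}^n\subset\mathbb{R}^{2|\mathcal{V}_n|}$ nonempty, convex and compact, and for every $(a^n,b^n)\in\mathcal{A}^n$ the entries of $b^n=(b_i)_{i\in\mathcal{V}_n}$ are all equal and positive. For $z_n\in\mathbb{R}$, $G^n(Y^n|z_n,a^n,b^n):=G^n\big((e^{a_i-b_i(z_n+c_i)})_{i\in\mathcal{V}_n}\big)$, and $\underline{\mathcal{G}}^n(z_n)=\min_{(a^n,b^n)\in\mathcal{A}^n}G^n(Y^n|z_n,a^n,b^n)$. "Found by bisection" means that each component of $z(p^G)$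 is obtained as the unique root of a scalar equation with a continuous strictly monotone function. *)

theory Defs
  imports "HOL-Analysis.Analysis"
begin

text \<open>
  A vector indexed by a subset \<open>S\<close> of the finite type \<open>'v\<close> of products is represented by the
  vector in \<open>real ^ 'v\<close> that is zero outside \<open>S\<close>. Thus \<open>coord_space S\<close> is a copy of the
  Euclidean space with coordinates indexed by \<open>S\<close>, and the blocks of a partition can have
  different dimensions.
\<close>

definition coord_space :: "'v::finite set \<Rightarrow> (real ^ 'v) set" where
  "coord_space S = {Y. \<forall>i. i \<notin> S \<longrightarrow> Y $ i = 0}"

definition pos_orthant :: "'v::finite set \<Rightarrow> (real ^ 'v) set" where
  "pos_orthant S = {Y \<in> coord_space S. \<forall>i\<in>S. 0 < Y $ i}"

definition partial_deriv :: "'v::finite \<Rightarrow> (real ^ 'v \<Rightarrow> real) \<Rightarrow> real ^ 'v \<Rightarrow> real" where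
  "partial_deriv i G Y = deriv (\<lambda>t. G (Y + t *\<^sub>R axis i 1)) 0"

definition partial_derivs :: "'v::finite list \<Rightarrow> (real ^ 'v \<Rightarrow> real) \<Rightarrow> real ^ 'v \<Rightarrow> real" where
  "partial_derivs js G = foldr partial_deriv js G"

text \<open>
  Smoothness: the iterated partial derivatives of all orders, repeated indices included, exist
  and are continuous. Partial derivatives are only taken in directions \<open>i \<in> S\<close>, so only the
  values of \<open>G\<close> on \<open>pos_orthant S\<close> matter here and in \<open>cpgf\<close>.
\<close>

definition smooth_on_orthant :: "'v::finite set \<Rightarrow> (real ^ 'v \<Rightarrow> real) \<Rightarrow> bool" where
  "smooth_on_orthant S G \<longleftrightarrow>
     (\<forall>js. set js \<subseteq> S \<longrightarrow>
        continuous_on (pos_orthant S) (partial_derivs js G) \<and>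
        (\<forall>i\<in>S. \<forall>Y\<in>pos_orthant S.
           (\<lambda>t. partial_derivs js G (Y + t *\<^sub>R axis i 1)) field_differentiable (at 0)))"

text \<open>
  The third conjunct is the limit as the single coordinate \<open>i\<close> tends to infinity, the other
  coordinates being fixed.
\<close>

definition cpgf :: "'v::finite set \<Rightarrow> (real ^ 'v \<Rightarrow> real) \<Rightarrow> bool" where
  "cpgf S G \<longleftrightarrow>
     smooth_on_orthant S G \<and>
     (\<forall>Y\<in>pos_orthant S. 0 \<le> G Y) \<and>
     (\<forall>Y\<in>pos_orthant S. \<forall>r>0. G (r *\<^sub>R Y) = r * G Y) \<and>
     (\<forall>Y\<in>pos_orthant S. \<forall>i\<in>S. filterlim (\<lambda>t. G (Y + t *\<^sub>R axis i 1)) at_top at_top) \<and>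
     (\<forall>Y\<in>pos_orthant S. \<forall>js. js \<noteq> [] \<and> distinct js \<and> set js \<subseteq> S \<longrightarrow>
        (odd (length js) \<longrightarrow> 0 < partial_derivs js G Y) \<and>
        (even (length js) \<longrightarrow> partial_derivs js G Y \<le> 0))"

definition gev_arg ::
  "'v::finite set \<Rightarrow> real ^ 'v \<Rightarrow> real \<Rightarrow> real ^ 'v \<Rightarrow> real ^ 'v \<Rightarrow> real ^ 'v" where
  "gev_arg S c x a b = (\<chi> i. if i \<in> S then exp (a $ i - b $ i * (x + c $ i)) else 0)"

text \<open>\<open>LEAST\<close> denotes the minimum of the set of values; it is unspecified if there is none.\<close>

definition worst_G ::
  "'v::finite set \<Rightarrow> real ^ 'v \<Rightarrow> (real ^ 'v \<Rightarrow> real) \<Rightarrow> ((real ^ 'v) \<times> (real ^ 'v)) set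
     \<Rightarrow> real \<Rightarrow> real" where
  "worst_G S c G A x = (LEAST y. \<exists>(a, b)\<in>A. y = G (gev_arg S c x a b))"

text \<open>
  In the following definitions, \<open>g n\<close> is the worst-case generating function of block \<open>n\<close> as a
  function of the single markup of that block.
\<close>

definition purchase_prob_eqs ::
  "('n::finite \<Rightarrow> real \<Rightarrow> real) \<Rightarrow> real ^ 'n \<Rightarrow> real ^ 'n \<Rightarrow> bool" where
  "purchase_prob_eqs g p z \<longleftrightarrow>
     (\<forall>n. p $ n = g n (z $ n) / (1 + (\<Sum>l\<in>UNIV. g l (z $ l))))"

definition markup_of :: "('n::finite \<Rightarrow> real \<Rightarrow> real) \<Rightarrow> real ^ 'n \<Rightarrow> real ^ 'n" where
  "markup_of g p = (THE z. purchase_prob_eqs g p z)"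

definition worst_revenue :: "('n::finite \<Rightarrow> real \<Rightarrow> real) \<Rightarrow> real ^ 'n \<Rightarrow> real" where
  "worst_revenue g z =
     (\<Sum>n\<in>UNIV. z $ n * g n (z $ n)) / (1 + (\<Sum>n\<in>UNIV. g n (z $ n)))"

definition prob_set :: "(real ^ 'n::finite) set" where
  "prob_set = {p. (\<forall>n. 0 < p $ n) \<and> (\<Sum>n\<in>UNIV. p $ n) < 1}"

definition strictly_concave_on :: "'a::real_vector set \<Rightarrow> ('a \<Rightarrow> real) \<Rightarrow> bool" where
  "strictly_concave_on S f \<longleftrightarrow>
     convex S \<and>
     (\<forall>x\<in>S. \<forall>y\<in>S. \<forall>t. x \<noteq> y \<and> 0 < t \<and> t < 1 \<longrightarrow>
        (1 - t) * f x + t * f y < f ((1 - t) *\<^sub>R x + t *\<^sub>R y))"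

end

theory Submission
  imports Defs
begin

text \<open>
  On a block with a common slope \<open>\<beta>\<close>, homogeneity gives \<open>G (Y(x)) = exp (- \<beta> * x) * G (Y(0))\<close>, so
  the logarithm of the worst-case generating function is a minimum of decreasing affine functions of
  the markup. It therefore has at every point \<open>u\<close> an affine majorant touching it at \<open>u\<close>, with slope
  at most some \<open>- \<beta>\<^sub>0 < 0\<close> (compactness). This yields continuity, monotonicity and bijectivity.

  With \<open>p\<^sub>0 = 1 - (\<Sum>n. p\<^sub>n)\<close> the markups solve \<open>g\<^sub>n z\<^sub>n = p\<^sub>n / p\<^sub>0\<close>, and the revenue is
  \<open>\<Sum>n. p\<^sub>n z\<^sub>n\<close>. If \<open>w\<close> are the markups of \<open>q\<close>, the majorant of \<open>ln g\<^sub>n\<close> at \<open>z\<^sub>n\<close> and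
  \<open>ln t \<le> t - 1\<close> at \<open>t = p\<^sub>n q\<^sub>0 / (p\<^sub>0 q\<^sub>n)\<close> give
  \<open>q\<^sub>n w\<^sub>n \<le> q\<^sub>n z\<^sub>n + (q\<^sub>0 p\<^sub>n / p\<^sub>0 - q\<^sub>n) / \<beta>\<^sub>n\<close>. The right-hand side is affine in \<open>q\<close> and touches
  at \<open>q = p\<close>; equality for all \<open>n\<close> would make the distributions \<open>(p\<^sub>0, p)\<close> and \<open>(q\<^sub>0, q)\<close>
  proportional, hence equal.
\<close>

section \<open>Strict concavity from affine majorants, and its domain\<close>

text \<open>The majorant at the intermediate point is evaluated at both end points. Averaging with
  weights \<open>1 - t\<close> and \<open>t\<close> cancels the linear terms, since the weighted
  displacements sum to zero.\<close>

lemma strictly_concave_onI_supergradient: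
  fixes f :: "'a::real_vector \<Rightarrow> real"
  assumes "convex S"
    and sup: "\<And>p. p \<in> S \<Longrightarrow> \<exists>L. linear L \<and> (\<forall>q\<in>S. q \<noteq> p \<longrightarrow> f q < f p + L (q - p))"
  shows "strictly_concave_on S f"
  unfolding strictly_concave_on_def
proof (intro conjI ballI allI impI)
  fix x y :: 'a and t :: real
  assume xy: "x \<in> S" "y \<in> S" and t: "x \<noteq> y \<and> 0 < t \<and> t < 1"
  let ?p = "(1 - t) *\<^sub>R x + t *\<^sub>R y"
  have "?p \<in> S"
    using convexD_alt[OF \<open>convex S\<close> xy, of t] t by auto
  then obtain L where L: "linear L" and *: "\<And>q. q \<in> S \<Longrightarrow> q \<noteq> ?p \<Longrightarrow> f q < f ?p + L (q - ?p)"
    using sup by blast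
  interpret L: linear L by (fact L)
  have x: "x - ?p = t *\<^sub>R (x - y)" and y: "y - ?p = - ((1 - t) *\<^sub>R (x - y))"
    by (simp_all add: algebra_simps)
  have "x \<noteq> ?p" "y \<noteq> ?p"
    using t x y by (metis diff_self less_irrefl right_minus_eq scaleR_eq_0_iff,
        metis diff_self less_irrefl right_minus_eq scaleR_eq_0_iff neg_equal_0_iff_equal)
  then have fx: "f x < f ?p + t * L (x - y)" and fy: "f y < f ?p - (1 - t) * L (x - y)"
    using *[of x] *[of y] xy unfolding x y by (simp_all add: L.scaleR L.neg)
  have "(1 - t) * f x + t * f y
      < (1 - t) * (f ?p + t * L (x - y)) + t * (f ?p - (1 - t) * L (x - y))"
    using mult_strict_left_mono[OF fx, of "1 - t"] mult_strict_left_mono[OF fy, of t] t by linarith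
  also have "\<dots> = f ?p"
    by (simp add: algebra_simps)
  finally show "(1 - t) * f x + t * f y < f ?p" .
qed (fact assms(1))

lemma convex_prob_set: "convex (prob_set :: (real ^ 'n::finite) set)"
proof -
  have "prob_set = (\<Inter>n. {p :: real ^ 'n. 0 < p $ n}) \<inter> {p. (\<Sum>n\<in>UNIV. p $ n) < 1}"
    by (auto simp: prob_set_def)
  moreover have "convex {p :: real ^ 'n. 0 < p $ n}" for n
    using convex_halfspace_gt[of 0 "axis n (1 :: real)"] by (simp add: inner_axis inner_commute)
  moreover have "convex {p :: real ^ 'n. (\<Sum>n\<in>UNIV. p $ n) < 1}"
    using convex_halfspace_lt[of "1 :: real ^ 'n" 1] by (simp add: inner_vec_def)
  ultimately show ?thesis
    by (metis (no_types, lifting) convex_Int convex_INT)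
qed

section \<open>Functions with uniformly steep affine majorants\<close>

text \<open>The bound \<open>\<beta>\<^sub>0\<close> is uniform in \<open>u\<close> in order to
  force unboundedness at both ends: \<open>- exp x\<close> has a decreasing majorant at every point,
  yet is bounded above.\<close>

definition steep_concave :: "(real \<Rightarrow> real) \<Rightarrow> bool" where
  "steep_concave h \<longleftrightarrow> (\<exists>\<beta>\<^sub>0>0. \<forall>u. \<exists>\<beta>\<ge>\<beta>\<^sub>0. \<forall>x. h x \<le> h u - \<beta> * (x - u))"

lemma steep_concaveE:
  assumes "steep_concave h"
  obtains \<beta> where "\<beta> > 0" "\<And>x. h x \<le> h u - \<beta> * (x - u)"
  using assms unfolding steep_concave_def by (meson less_le_trans)

lemma steep_concave_strict_antimono:
  assumes "steep_concave h" "x < y"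
  shows "h y < h x"
proof -
  obtain \<beta> where "\<beta> > 0" "h y \<le> h x - \<beta> * (y - x)"
    using assms(1) by (metis steep_concaveE)
  moreover have "\<beta> * (y - x) > 0"
    using \<open>\<beta> > 0\<close> \<open>x < y\<close> by simp
  ultimately show ?thesis by linarith
qed

text \<open>Averaging the majorant at a convex combination gives concavity, and a finite concave
  function on the whole line is continuous.\<close>

lemma steep_concave_continuous:
  assumes "steep_concave h"
  shows "continuous_on UNIV h"
proof -
  have "convex_on UNIV (\<lambda>x. - h x)"
  proof (rule convex_onI)
    fix t x y :: real
    assume t: "0 < t" "t < 1"
    let ?u = "(1 - t) *\<^sub>R x + t *\<^sub>R y"
    obtain \<beta> where \<beta>: "\<And>x. h x \<le> h ?u - \<beta> * (x - ?u)"
      using assms by (metis steep_concaveE)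
    have "(1 - t) * h x + t * h y \<le> (1 - t) * (h ?u - \<beta> * (x - ?u)) + t * (h ?u - \<beta> * (y - ?u))"
      using t by (intro add_mono mult_left_mono \<beta>) auto
    also have "\<dots> = h ?u"
      by (simp add: algebra_simps)
    finally show "- h ?u \<le> (1 - t) * - h x + t * - h y"
      by simp
  qed auto
  then have "continuous_on UNIV (\<lambda>x. - h x)"
    by (intro convex_on_continuous) auto
  then show ?thesis
    using continuous_on_minus by fastforce
qed

lemma steep_concave_surj:
  assumes "steep_concave h"
  shows "\<exists>x. h x = y"
proof -
  obtain \<beta>\<^sub>0 where \<beta>\<^sub>0: "\<beta>\<^sub>0 > 0" "\<And>u. \<exists>\<beta>\<ge>\<beta>\<^sub>0. \<forall>x. h x \<le> h u - \<beta> * (x - u)"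
    using assms unfolding steep_concave_def by blast
  have drop: "h v \<le> h u - \<beta>\<^sub>0 * (v - u)" if "u \<le> v" for u v
  proof -
    obtain \<beta> where "\<beta> \<ge> \<beta>\<^sub>0" "h v \<le> h u - \<beta> * (v - u)"
      using \<beta>\<^sub>0(2)[of u] by blast
    moreover have "\<beta>\<^sub>0 * (v - u) \<le> \<beta> * (v - u)"
      using \<open>\<beta> \<ge> \<beta>\<^sub>0\<close> that by (intro mult_right_mono) auto
    ultimately show ?thesis by linarith
  qed
  \<comment> \<open>Over a distance \<open>?r\<close> the function falls by at least the gap between
    \<open>y\<close> and \<open>h 0\<close>, so \<open>y\<close> is crossed within that distance of
    0.\<close>
  let ?r = "\<bar>y - h 0\<bar> / \<beta>\<^sub>0"
  have r: "0 \<le> ?r" "\<beta>\<^sub>0 * ?r = \<bar>y - h 0\<bar>"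
    using \<beta>\<^sub>0(1) by auto
  have "h ?r \<le> y" "y \<le> h (- ?r)"
    using drop[of 0 ?r] drop[of "- ?r" 0] r by auto
  moreover have "continuous_on {- ?r .. ?r} h"
    using steep_concave_continuous[OF assms] continuous_on_subset by blast
  ultimately show ?thesis
    using IVT2'[of h ?r y "- ?r"] r(1) by auto
qed

section \<open>The worst-case generating function of one block\<close>

lemma gev_arg_in_pos_orthant: "gev_arg S c x a b \<in> pos_orthant S"
  by (auto simp: gev_arg_def pos_orthant_def coord_space_def)

text \<open>A common slope turns a change of markup into one scalar factor, the form to which
  homogeneity applies.\<close>

lemma gev_arg_shift:
  assumes "\<And>i. i \<in> S \<Longrightarrow> b $ i = \<beta>"
  shows "gev_arg S c x a b = exp (- \<beta> * (x - u)) *\<^sub>R gev_arg S c u a b"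
  using assms
  by (auto simp: gev_arg_def vec_eq_iff exp_add[symmetric] algebra_simps)

text \<open>The axioms give only nonnegativity. A zero value is excluded because the first partial
  derivatives are positive: lowering one coordinate slightly would make \<open>G\<close>
  negative.\<close>

lemma cpgf_pos:
  assumes "cpgf S G" "S \<noteq> {}" "Y \<in> pos_orthant S"
  shows "0 < G Y"
proof -
  obtain i where i: "i \<in> S"
    using assms(2) by blast
  let ?\<phi> = "\<lambda>t. G (Y + t *\<^sub>R axis i 1)"
  have "smooth_on_orthant S G"
    using assms(1) by (simp add: cpgf_def)
  then have "?\<phi> field_differentiable (at 0)"
    unfolding smooth_on_orthant_def using i assms(3)
    by (auto dest!: spec[of _ "[]"] simp: partial_derivs_def)
  then have "(?\<phi> has_real_derivative partial_deriv i G Y) (at 0)"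
    by (simp add: partial_deriv_def DERIV_deriv_iff_field_differentiable)
  moreover have "0 < partial_derivs [i] G Y"
    using assms(1,3) i unfolding cpgf_def by (auto dest!: bspec[of _ _ Y] spec[of _ "[i]"])
  ultimately obtain d where d: "d > 0" "\<And>s. 0 < s \<Longrightarrow> s < d \<Longrightarrow> ?\<phi> (0 - s) < ?\<phi> 0"
    using DERIV_pos_inc_left[of ?\<phi> "partial_deriv i G Y" 0] by (auto simp: partial_derivs_def)
  \<comment> \<open>Small enough both for the decrease of \<open>?\<phi>\<close> and for staying
    inside the orthant.\<close>
  define s where "s = min d (Y $ i) / 2"
  have Yi: "Y $ i > 0"
    using assms(3) i by (auto simp: pos_orthant_def)
  then have s: "0 < s" "s < d" "s < Y $ i"
    using d(1) by (auto simp: s_def min_def)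
  then have "Y + (- s) *\<^sub>R axis i 1 \<in> pos_orthant S"
    using assms(3) i by (auto simp: pos_orthant_def coord_space_def axis_def)
  then have "0 \<le> ?\<phi> (- s)"
    using assms(1) unfolding cpgf_def by blast
  also have "\<dots> < G Y"
    using d(2)[OF s(1,2)] by simp
  finally show ?thesis .
qed

text \<open>Compactness supplies the minimum that makes the \<open>LEAST\<close> in
  \<open>worst_G\<close> meaningful.\<close>

lemma worst_G_attained:
  assumes "cpgf S G" "A \<noteq> {}" "compact A"
  obtains a b where "(a, b) \<in> A" "worst_G S c G A x = G (gev_arg S c x a b)"
    "\<And>a' b'. (a', b') \<in> A \<Longrightarrow> G (gev_arg S c x a b) \<le> G (gev_arg S c x a' b')"
proof -
  have "continuous_on (pos_orthant S) G"
    using assms(1) unfolding cpgf_def smooth_on_orthant_def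
    by (auto dest!: spec[of _ "[]"] simp: partial_derivs_def)
  moreover have "continuous_on A (\<lambda>ab. gev_arg S c x (fst ab) (snd ab))"
    unfolding gev_arg_def
    by (rule continuous_on_vec_lambda, case_tac "i \<in> S") (auto intro!: continuous_intros)
  ultimately have "continuous_on A (\<lambda>ab. G (gev_arg S c x (fst ab) (snd ab)))"
    by (rule continuous_on_compose2) (auto simp: gev_arg_in_pos_orthant)
  then obtain a b where ab: "(a, b) \<in> A"
    "\<And>a' b'. (a', b') \<in> A \<Longrightarrow> G (gev_arg S c x a b) \<le> G (gev_arg S c x a' b')"
    using continuous_attains_inf[OF assms(3,2)] by fastforce
  then have "worst_G S c G A x = G (gev_arg S c x a b)"
    unfolding worst_G_def by (intro Least_equality) auto
  with ab that show thesis by blast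
qed

lemma worst_G_pos:
  assumes "cpgf S G" "S \<noteq> {}" "A \<noteq> {}" "compact A"
  shows "0 < worst_G S c G A x"
  using worst_G_attained[OF assms(1,3,4)] cpgf_pos[OF assms(1,2)] gev_arg_in_pos_orthant
  by metis

lemma worst_G_steep_concave:
  assumes "cpgf S G" "S \<noteq> {}" "A \<noteq> {}" "compact A"
    and slopes: "\<And>a b. (a, b) \<in> A \<Longrightarrow> \<exists>\<beta>>0. \<forall>i\<in>S. b $ i = \<beta>"
  shows "steep_concave (\<lambda>x. ln (worst_G S c G A x))"
proof -
  let ?g = "worst_G S c G A"
  obtain i where i: "i \<in> S"
    using assms(2) by blast
  have "continuous_on A (\<lambda>ab. snd ab $ i)"
    by (intro continuous_intros)
  \<comment> \<open>The smallest slope over the compact set is attained, hence positive; it serves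
    as \<open>\<beta>\<^sub>0\<close>. A single coordinate \<open>i\<close> suffices, as the slopes
    agree on the block.\<close>
  then obtain a\<^sub>0 b\<^sub>0 where m: "(a\<^sub>0, b\<^sub>0) \<in> A" "\<And>a b. (a, b) \<in> A \<Longrightarrow> b\<^sub>0 $ i \<le> b $ i"
    using continuous_attains_inf[OF assms(4,3)] by fastforce
  have "b\<^sub>0 $ i > 0"
    using slopes[OF m(1)] i by auto
  moreover have "\<exists>\<beta>\<ge>b\<^sub>0 $ i. \<forall>x. ln (?g x) \<le> ln (?g u) - \<beta> * (x - u)" for u
  proof -
    \<comment> \<open>The minimiser at \<open>u\<close> remains a competitor at every
      \<open>x\<close>, so its slope yields the majorant touching at \<open>u\<close>.\<close>
    obtain a b where ab: "(a, b) \<in> A" "?g u = G (gev_arg S c u a b)"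
      using worst_G_attained[OF assms(1,3,4)] by metis
    define \<beta> where "\<beta> = b $ i"
    have \<beta>: "b $ j = \<beta>" if "j \<in> S" for j
      using slopes[OF ab(1)] i that by (auto simp: \<beta>_def)
    have "ln (?g x) \<le> ln (?g u) - \<beta> * (x - u)" for x
    proof -
      have shift: "gev_arg S c x a b = exp (- \<beta> * (x - u)) *\<^sub>R gev_arg S c u a b"
        by (rule gev_arg_shift) (rule \<beta>)
      have "?g x \<le> G (gev_arg S c x a b)"
        using worst_G_attained[OF assms(1,3,4)] ab(1) by metis
      also have "\<dots> = exp (- \<beta> * (x - u)) * ?g u"
        unfolding ab(2) shift using assms(1) by (simp add: cpgf_def gev_arg_in_pos_orthant)
      finally have "ln (?g x) \<le> ln (exp (- \<beta> * (x - u)) * ?g u)"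
        using worst_G_pos[OF assms(1-4)] by (subst ln_le_cancel_iff) auto
      also have "\<dots> = ln (?g u) - \<beta> * (x - u)"
        using worst_G_pos[OF assms(1-4), of c u] by (subst ln_mult) auto
      finally show ?thesis .
    qed
    moreover have "\<beta> \<ge> b\<^sub>0 $ i"
      using m(2)[OF ab(1)] by (simp add: \<beta>_def)
    ultimately show ?thesis by blast
  qed
  ultimately show ?thesis
    unfolding steep_concave_def by blast
qed

section \<open>Decoupling the equations, and concavity of the revenue\<close>

text \<open>Summing over \<open>n\<close> identifies \<open>1 - P\<close> with
  \<open>1 / (1 + S)\<close>. Each equation then involves only its own markup, which reduces the
  system to scalar root finding.\<close>

lemma purchase_prob_eqs_iff:
  fixes g :: "'n::finite \<Rightarrow> real \<Rightarrow> real"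
  assumes pos: "\<And>n x. 0 < g n x" and p: "p \<in> prob_set"
  shows "purchase_prob_eqs g p z \<longleftrightarrow> (\<forall>n. g n (z $ n) = p $ n / (1 - (\<Sum>l\<in>UNIV. p $ l)))"
proof -
  define S where "S = (\<Sum>l\<in>UNIV. g l (z $ l))"
  define P where "P = (\<Sum>l\<in>UNIV. p $ l)"
  have S: "1 + S > 0"
    using pos by (simp add: S_def sum_pos add_pos_pos)
  have P: "1 - P > 0"
    using p by (simp add: prob_set_def P_def)
  have "g n (z $ n) = p $ n / (1 - P)" if eq: "\<And>n. p $ n = g n (z $ n) / (1 + S)" for n
  proof -
    have "P = S / (1 + S)"
      unfolding P_def S_def[symmetric] using eq by (simp add: S_def sum_divide_distrib)
    then have "1 - P = 1 / (1 + S)"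
      using S by (simp add: field_simps)
    then show ?thesis
      using eq[of n] S by simp
  qed
  moreover have "p $ n = g n (z $ n) / (1 + S)" if eq: "\<And>n. g n (z $ n) = p $ n / (1 - P)" for n
  proof -
    have "S = P / (1 - P)"
      unfolding S_def using eq by (simp add: P_def sum_divide_distrib)
    then have "1 + S = 1 / (1 - P)"
      using P by (simp add: field_simps)
    then show ?thesis
      using eq[of n] P by simp
  qed
  ultimately show ?thesis
    unfolding purchase_prob_eqs_def S_def[symmetric] P_def[symmetric] by blast
qed

lemma worst_revenue_eq:
  assumes "purchase_prob_eqs g p z"
  shows "worst_revenue g z = (\<Sum>n\<in>UNIV. p $ n * z $ n)"
  using assms
  by (simp add: worst_revenue_def purchase_prob_eqs_def sum_divide_distrib mult.commute)

lemma ratio_markup_le: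
  fixes p q p\<^sub>0 q\<^sub>0 z w \<beta> :: real
  assumes pos: "0 < p" "0 < q" "0 < p\<^sub>0" "0 < q\<^sub>0" "0 < \<beta>"
    and le: "ln (q / q\<^sub>0) \<le> ln (p / p\<^sub>0) - \<beta> * (w - z)"
  shows "q * w \<le> q * z + (q\<^sub>0 * p / p\<^sub>0 - q) / \<beta>"
    and "p / p\<^sub>0 \<noteq> q / q\<^sub>0 \<Longrightarrow> q * w < q * z + (q\<^sub>0 * p / p\<^sub>0 - q) / \<beta>"
proof -
  define t where "t = (p / p\<^sub>0) / (q / q\<^sub>0)"
  have t: "t > 0"
    using pos by (simp add: t_def)
  have "\<beta> * (w - z) \<le> ln t"
    using le pos by (simp add: t_def ln_div ln_mult)
  then have "w - z \<le> ln t / \<beta>"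
    using pos by (simp add: pos_le_divide_eq mult.commute)
  then have *: "q * w \<le> q * z + q * ln t / \<beta>"
    using mult_left_mono[of "w - z" "ln t / \<beta>" q] pos by (simp add: algebra_simps)
  \<comment> \<open>Weighting by \<open>q\<close> clears the denominator of \<open>t\<close>, which
    makes the bound affine in the pair of \<open>q\<close> and \<open>q\<^sub>0\<close>.\<close>
  have **: "q * (t - 1) = q\<^sub>0 * p / p\<^sub>0 - q"
    using pos by (simp add: t_def field_simps)
  have "q * ln t / \<beta> \<le> q * (t - 1) / \<beta>"
    using pos ln_le_minus_one[OF t] by (intro divide_right_mono mult_left_mono) auto
  with * ** show "q * w \<le> q * z + (q\<^sub>0 * p / p\<^sub>0 - q) / \<beta>"
    by simp
  assume "p / p\<^sub>0 \<noteq> q / q\<^sub>0"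
  then have "t \<noteq> 1"
    using pos unfolding t_def by (metis divide_eq_1_iff)
  then have "ln t < t - 1"
    using ln_le_minus_one[OF t] ln_eq_minus_one[OF t] by fastforce
  then have "q * ln t / \<beta> < q * (t - 1) / \<beta>"
    using pos by (intro divide_strict_right_mono mult_strict_left_mono) auto
  with * ** show "q * w < q * z + (q\<^sub>0 * p / p\<^sub>0 - q) / \<beta>"
    by simp
qed

text \<open>The ratios sum to \<open>P / (1 - P)\<close>, which is injective in \<open>P\<close>
  below 1; the total then determines every entry.\<close>

lemma prob_set_eqI:
  fixes p q :: "real ^ 'n::finite"
  assumes "p \<in> prob_set" "q \<in> prob_set"
    and eq: "\<And>n. p $ n / (1 - (\<Sum>l\<in>UNIV. p $ l)) = q $ n / (1 - (\<Sum>l\<in>UNIV. q $ l))"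
  shows "p = q"
proof -
  define P where "P = (\<Sum>l\<in>UNIV. p $ l)"
  define Q where "Q = (\<Sum>l\<in>UNIV. q $ l)"
  have PQ: "P < 1" "Q < 1"
    using assms(1,2) by (auto simp: prob_set_def P_def Q_def)
  have "P / (1 - P) = Q / (1 - Q)"
    using eq by (simp add: P_def Q_def sum_divide_distrib)
  then have "P = Q"
    using PQ by (simp add: field_simps)
  then show ?thesis
    using eq PQ by (auto simp: vec_eq_iff P_def[symmetric] Q_def[symmetric])
qed

lemma sum_markup_strictly_concave:
  fixes h :: "'n::finite \<Rightarrow> real \<Rightarrow> real" and Z :: "real ^ 'n \<Rightarrow> real ^ 'n"
  assumes h: "\<And>n. steep_concave (h n)"
    and Z: "\<And>p n. p \<in> prob_set \<Longrightarrow> h n (Z p $ n) = ln (p $ n / (1 - (\<Sum>l\<in>UNIV. p $ l)))"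
  shows "strictly_concave_on prob_set (\<lambda>p. \<Sum>n\<in>UNIV. p $ n * Z p $ n)"
proof (rule strictly_concave_onI_supergradient[OF convex_prob_set])
  fix p :: "real ^ 'n"
  assume p: "p \<in> prob_set"
  define r where "r = (\<lambda>q :: real ^ 'n. 1 - (\<Sum>l\<in>UNIV. q $ l))"
  have r: "0 < r q" and pos: "0 < q $ n" if "q \<in> prob_set" for q n
    using that by (auto simp: prob_set_def r_def)
  have "\<exists>\<beta>>0. \<forall>x. h n x \<le> h n (Z p $ n) - \<beta> * (x - Z p $ n)" for n
    using h by (metis steep_concaveE)
  then obtain \<beta> where \<beta>: "\<And>n. \<beta> n > 0" "\<And>n x. h n x \<le> h n (Z p $ n) - \<beta> n * (x - Z p $ n)"
    by metis
  \<comment> \<open>The linear part of the summed bounds of \<open>ratio_markup_le\<close> at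
    \<open>q = p + d\<close>: the outside share falls by the sum of \<open>d\<close>, and the
    constant part is the revenue at \<open>p\<close>.\<close>
  define L where "L = (\<lambda>d :: real ^ 'n. \<Sum>n\<in>UNIV.
    d $ n * Z p $ n - ((\<Sum>l\<in>UNIV. d $ l) * (p $ n / r p) + d $ n) / \<beta> n)"
  have "linear L"
    unfolding L_def
    by (intro linear_compose_sum ballI linearI)
      (simp_all add: sum.distrib sum_distrib_left[symmetric] add_divide_distrib diff_divide_distrib
        distrib_left distrib_right right_diff_distrib mult.assoc)
  moreover have "(\<Sum>n\<in>UNIV. q $ n * Z q $ n) < (\<Sum>n\<in>UNIV. p $ n * Z p $ n) + L (q - p)"
    if q: "q \<in> prob_set" and "q \<noteq> p" for q
  proof -
    let ?R = "\<lambda>n. q $ n * Z p $ n + (r q * p $ n / r p - q $ n) / \<beta> n"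
    have le: "ln (q $ n / r q) \<le> ln (p $ n / r p) - \<beta> n * (Z q $ n - Z p $ n)" for n
      using \<beta>(2)[of n "Z q $ n"] Z[OF p] Z[OF q] by (simp add: r_def)
    note bounds = ratio_markup_le[OF pos[OF p] pos[OF q] r[OF p] r[OF q] \<beta>(1) le]
    have "\<exists>n. p $ n / r p \<noteq> q $ n / r q"
      using prob_set_eqI[OF p q] \<open>q \<noteq> p\<close> by (auto simp: r_def)
    \<comment> \<open>One strict inequality among the weak ones is enough for the sum.\<close>
    then have "(\<Sum>n\<in>UNIV. q $ n * Z q $ n) < (\<Sum>n\<in>UNIV. ?R n)"
      using bounds by (intro sum_strict_mono_ex1) auto
    also have "?R n = p $ n * Z p $ n
        + ((q - p) $ n * Z p $ n - ((\<Sum>l\<in>UNIV. (q - p) $ l) * (p $ n / r p) + (q - p) $ n) / \<beta> n)" for n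
    proof -
      have mass: "(\<Sum>l\<in>UNIV. (q - p) $ l) = r p - r q"
        by (simp add: r_def sum_subtractf)
      show ?thesis
        unfolding mass using r[OF p] \<beta>(1)[of n] by (simp add: field_simps)
    qed
    then have "(\<Sum>n\<in>UNIV. ?R n) = (\<Sum>n\<in>UNIV. p $ n * Z p $ n) + L (q - p)"
      by (simp add: L_def sum.distrib)
    finally show ?thesis .
  qed
  ultimately show "\<exists>L. linear L \<and> (\<forall>q\<in>prob_set. q \<noteq> p \<longrightarrow>
      (\<Sum>n\<in>UNIV. q $ n * Z q $ n) < (\<Sum>n\<in>UNIV. p $ n * Z p $ n) + L (q - p))"
    by blast
qed

text \<open>Bisection is expressed by the conjuncts under the inner quantifier over
  \<open>n\<close>: a continuous strictly decreasing function, a unique root, and the component of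
  \<open>markup_of\<close> being that root.\<close>

theorem theorem2:
  fixes V :: "'n::finite \<Rightarrow> 'v::finite set"
    and c :: "real ^ 'v"
    and G :: "'n \<Rightarrow> real ^ 'v \<Rightarrow> real"
    and A :: "'n \<Rightarrow> ((real ^ 'v) \<times> (real ^ 'v)) set"
    and g :: "'n \<Rightarrow> real \<Rightarrow> real"
  assumes part_nonempty: "\<And>n. V n \<noteq> {}"
    and part_disjoint: "\<And>n l. n \<noteq> l \<Longrightarrow> V n \<inter> V l = {}"
    and part_cover: "(\<Union>n. V n) = UNIV"
    and cpgf: "\<And>n. cpgf (V n) (G n)"
    and A_space: "\<And>n. A n \<subseteq> coord_space (V n) \<times> coord_space (V n)"
    and A_nonempty: "\<And>n. A n \<noteq> {}"
    and A_convex: "\<And>n. convex (A n)"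
    and A_compact: "\<And>n. compact (A n)"
    and A_slopes: "\<And>n a b. (a, b) \<in> A n \<Longrightarrow> \<exists>\<beta>>0. \<forall>i\<in>V n. b $ i = \<beta>"
  defines "g \<equiv> \<lambda>n. worst_G (V n) c (G n) (A n)"
  shows "(\<forall>p\<in>prob_set.
            (\<exists>!z. purchase_prob_eqs g p z) \<and>
            (\<forall>n. continuous_on UNIV (g n) \<and>
                 (\<forall>x y. x < y \<longrightarrow> g n y < g n x) \<and>
                 (\<exists>!x. g n x = p $ n / (1 - (\<Sum>l\<in>UNIV. p $ l))) \<and>
                 g n (markup_of g p $ n) = p $ n / (1 - (\<Sum>l\<in>UNIV. p $ l)))) \<and>
         strictly_concave_on prob_set (\<lambda>p. worst_revenue g (markup_of g p))"
proof -
  define h where "h = (\<lambda>n x. ln (g n x))"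
  have pos: "0 < g n x" for n x
    unfolding g_def by (intro worst_G_pos cpgf part_nonempty A_nonempty A_compact)
  have h: "steep_concave (h n)" for n
    unfolding h_def g_def
    by (intro worst_G_steep_concave cpgf part_nonempty A_nonempty A_compact A_slopes)
  have g_h: "g n = (\<lambda>x. exp (h n x))" for n
    using pos by (simp add: h_def)
  have cont: "continuous_on UNIV (g n)" for n
    unfolding g_h by (intro continuous_intros steep_concave_continuous h)
  have anti: "g n y < g n x" if "x < y" for n x y
    using steep_concave_strict_antimono[OF h that] by (simp add: g_h)
  have root: "\<exists>!x. g n x = y" if y: "y > 0" for n y
  proof (rule ex_ex1I)
    show "\<exists>x. g n x = y"
    proof -
      obtain x where "h n x = ln y"
        using steep_concave_surj[OF h] by blast
      then show ?thesis
        using y by (intro exI[of _ x]) (simp add: g_h)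
    qed
  qed (metis anti less_irrefl linorder_neqE)
  define target where "target = (\<lambda>(p :: real ^ 'n) n. p $ n / (1 - (\<Sum>l\<in>UNIV. p $ l)))"
  have target: "target p n > 0" if "p \<in> prob_set" for p n
    using that by (simp add: prob_set_def target_def)
  have eqs_iff: "purchase_prob_eqs g p z \<longleftrightarrow> (\<forall>n. g n (z $ n) = target p n)"
    if "p \<in> prob_set" for p z
    using purchase_prob_eqs_iff[OF pos that] by (simp add: target_def)
  have unique: "\<exists>!z. purchase_prob_eqs g p z" if p: "p \<in> prob_set" for p
  proof -
    have ex1: "\<exists>!x. g n x = target p n" for n
      by (rule root[OF target[OF p]])
    then have "\<forall>n. \<exists>x. g n x = target p n"
      by blast
    then obtain f where "\<forall>n. g n (f n) = target p n"
      by (rule choice[THEN exE])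
    then have "purchase_prob_eqs g p (\<chi> n. f n)"
      by (simp add: eqs_iff[OF p])
    moreover have "z = w" if "purchase_prob_eqs g p z" "purchase_prob_eqs g p w" for z w
      using that ex1 unfolding eqs_iff[OF p] vec_eq_iff by blast
    ultimately show ?thesis by blast
  qed
  have markup: "purchase_prob_eqs g p (markup_of g p)" if "p \<in> prob_set" for p
    unfolding markup_of_def by (rule theI'[OF unique[OF that]])
  have markup_target: "g n (markup_of g p $ n) = target p n" if "p \<in> prob_set" for p n
    using markup[OF that] eqs_iff[OF that] by blast
  have "strictly_concave_on prob_set (\<lambda>p. \<Sum>n\<in>UNIV. p $ n * markup_of g p $ n)"
    by (rule sum_markup_strictly_concave[of h]) (use h markup_target in \<open>simp_all add: h_def target_def\<close>)
  moreover have "worst_revenue g (markup_of g p) = (\<Sum>n\<in>UNIV. p $ n * markup_of g p $ n)"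
    if "p \<in> prob_set" for p
    using worst_revenue_eq[OF markup[OF that]] .
  \<comment> \<open>The revenue formula holds only on \<open>prob_set\<close>, so convexity is used
    to apply it at the intermediate point.\<close>
  ultimately have "strictly_concave_on prob_set (\<lambda>p. worst_revenue g (markup_of g p))"
    unfolding strictly_concave_on_def by (simp add: convexD_alt)
  then show ?thesis
    using unique cont anti root[OF target] markup_target
    unfolding target_def by (intro conjI ballI allI impI) simp_all
qed

end
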